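(* Let $\lambda_n, a, b, \mu$ be constants with $\mu\neq 0$. The quadratic polynomial differential system $$\begin{cases}\dot v=\dfrac{\lambda_n}{\mu}(1-x^2)+a v x+b v+\mu v^2,\\ \dot x=1-x^2\end{cases}$$ has a Darboux invariant of the form $$I(v,x,t)=\frac{\sqrt{x-1}}{\sqrt{x+1}}\,e^{t}.$$
   Context: Polynomial systems are considered over $\mathbb{C}$ when Darboux integrability is discussed, and the square roots are regarded as (multivalued) complex functions; identities are understood for local analytic branches where $x\neq\pm1$. For a polynomial system $\dot v=P(v,x)$, $\dot x=Q(v,x)$ with associated vector field $X=P\,\partial/\partial v+Q\,\partial/\partial x$, an irreducible polynomial $f$ defines an invariant algebraic curve $f=0$ with cofactor $K$ (a polynomial) if $Xf=Kf$. An invariant of the system is a non-constant function $I(v,x,t)$, depending on time $t$, that is constant along solutions, i.e. $\frac{\partial I}{\partial t}+P\frac{\partial I}{\partial v}+Q\frac{\partial I}{\partial x}=0$. It is a Darboux invariant if it has the form $f_1^{\lambda_1}\cdots f_p^{\lambda_p}F_1^{\mu_1}\cdots F_q^{\mu_q}e^{st}$ with $s\in\mathbb{C}\setminus\{0\}$, exponents $\lambda_i,\mu_j\in\mathbb{C}$ not all zero, where $f_i=0$ are irreducible invariant algebraic curves and $F_j$ are exponential factors (functions of the form $\exp(g_j/h_j)$ with $g_j,h_j$ polynomials such that $XF_j=L_jF_j$ for some polynomial $L_j$); $p$ or $q$ may be zero. *)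

theory Defs
  imports "HOL-Complex_Analysis.Complex_Analysis" "HOL-Computational_Algebra.Computational_Algebra"
begin

text \<open>Polynomials in \<open>\<complex>[v,x]\<close> are represented in \<open>\<complex>[x][v]\<close>: the outer variable is \<open>v\<close>,
  the inner one is \<open>x\<close>.\<close>

type_synonym poly_vx = "complex poly poly"

definition var_v :: poly_vx where
  "var_v = [:0, 1:]"

definition var_x :: poly_vx where
  "var_x = [:[:0, 1:]:]"

definition const_vx :: "complex \<Rightarrow> poly_vx" where
  "const_vx c = [:[:c:]:]"

definition eval_vx :: "poly_vx \<Rightarrow> complex \<Rightarrow> complex \<Rightarrow> complex" where
  "eval_vx p v x = poly (poly p [:v:]) x"

text \<open>The vector field \<open>P \<partial>/\<partial>v + Q \<partial>/\<partial>x\<close>, acting on polynomials and on functions.\<close>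

definition vfield_poly :: "poly_vx \<Rightarrow> poly_vx \<Rightarrow> poly_vx \<Rightarrow> poly_vx" where
  "vfield_poly P Q f = P * pderiv f + Q * map_poly pderiv f"

definition vfield_fun ::
  "poly_vx \<Rightarrow> poly_vx \<Rightarrow> (complex \<Rightarrow> complex \<Rightarrow> complex) \<Rightarrow> complex \<Rightarrow> complex \<Rightarrow> complex" where
  "vfield_fun P Q F v x =
     eval_vx P v x * deriv (\<lambda>w. F w x) v + eval_vx Q v x * deriv (\<lambda>y. F v y) x"

definition invariant_algebraic_curve :: "poly_vx \<Rightarrow> poly_vx \<Rightarrow> poly_vx \<Rightarrow> bool" where
  "invariant_algebraic_curve P Q f \<longleftrightarrow> irreducible f \<and> (\<exists>K. vfield_poly P Q f = K * f)"

definition exp_quotient :: "poly_vx \<Rightarrow> poly_vx \<Rightarrow> complex \<Rightarrow> complex \<Rightarrow> complex" where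
  "exp_quotient g h v x = exp (eval_vx g v x / eval_vx h v x)"

text \<open>The function \<open>exp (g/h)\<close> lives on the set where \<open>h\<close> does not vanish; there it is
  differentiable, so that \<^const>\<open>deriv\<close> is meaningful.\<close>

definition exponential_factor :: "poly_vx \<Rightarrow> poly_vx \<Rightarrow> poly_vx \<Rightarrow> poly_vx \<Rightarrow> bool" where
  "exponential_factor P Q g h \<longleftrightarrow> h \<noteq> 0 \<and>
     (\<exists>L. \<forall>v x. eval_vx h v x \<noteq> 0 \<longrightarrow>
        vfield_fun P Q (exp_quotient g h) v x = eval_vx L v x * exp_quotient g h v x)"

text \<open>Branches on an open set \<open>U\<close> of the \<open>(v,x)\<close>-space. A continuous square root or logarithm of
  a nowhere vanishing analytic function is analytic, so continuity is all that is asked for.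
  The logarithm defining a branch of \<open>f\<close> to the power \<open>c\<close> is only required locally: a branch of
  the power may exist on \<open>U\<close> although the logarithm has no branch on all of \<open>U\<close>.\<close>

definition sqrt_branch ::
  "(complex \<times> complex) set \<Rightarrow> (complex \<Rightarrow> complex \<Rightarrow> complex) \<Rightarrow> (complex \<Rightarrow> complex \<Rightarrow> complex) \<Rightarrow> bool"
  where
  "sqrt_branch U f r \<longleftrightarrow>
     continuous_on U (\<lambda>(v, x). r v x) \<and> (\<forall>(v, x)\<in>U. (r v x)\<^sup>2 = f v x)"

definition power_branch ::
  "(complex \<times> complex) set \<Rightarrow> (complex \<Rightarrow> complex \<Rightarrow> complex) \<Rightarrow> complex
     \<Rightarrow> (complex \<Rightarrow> complex \<Rightarrow> complex) \<Rightarrow> bool"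
  where
  "power_branch U f c \<phi> \<longleftrightarrow>
     (\<forall>z\<in>U. \<exists>V l. open V \<and> z \<in> V \<and> V \<subseteq> U \<and> continuous_on V (\<lambda>(v, x). l v x) \<and>
        (\<forall>(v, x)\<in>V. exp (l v x) = f v x \<and> \<phi> v x = exp (c * l v x)))"

definition is_invariant ::
  "poly_vx \<Rightarrow> poly_vx \<Rightarrow> (complex \<times> complex) set \<Rightarrow> (complex \<Rightarrow> complex \<Rightarrow> complex \<Rightarrow> complex) \<Rightarrow> bool"
  where
  "is_invariant P Q U I \<longleftrightarrow>
     \<not> (\<exists>c. \<forall>(v, x)\<in>U. \<forall>t. I v x t = c) \<and>
     (\<forall>(v, x)\<in>U. \<forall>t.
        (\<lambda>w. I w x t) field_differentiable at v \<and>
        (\<lambda>y. I v y t) field_differentiable at x \<and>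
        (\<lambda>u. I v x u) field_differentiable at t \<and>
        deriv (\<lambda>u. I v x u) t + vfield_fun P Q (\<lambda>w y. I w y t) v x = 0)"

definition darboux_invariant ::
  "poly_vx \<Rightarrow> poly_vx \<Rightarrow> (complex \<times> complex) set \<Rightarrow> (complex \<Rightarrow> complex \<Rightarrow> complex \<Rightarrow> complex) \<Rightarrow> bool"
  where
  "darboux_invariant P Q U I \<longleftrightarrow> is_invariant P Q U I \<and>
     (\<exists>(p::nat) (q::nat) f c \<phi> g h d \<psi> s.
        (\<forall>i<p. invariant_algebraic_curve P Q (f i) \<and>
               power_branch U (eval_vx (f i)) (c i) (\<phi> i)) \<and>
        (\<forall>j<q. exponential_factor P Q (g j) (h j) \<and>
               (\<forall>(v, x)\<in>U. eval_vx (h j) v x \<noteq> 0) \<and>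
               power_branch U (exp_quotient (g j) (h j)) (d j) (\<psi> j)) \<and>
        ((\<exists>i<p. c i \<noteq> 0) \<or> (\<exists>j<q. d j \<noteq> 0)) \<and>
        s \<noteq> 0 \<and>
        (\<forall>(v, x)\<in>U. \<forall>t. I v x t = (\<Prod>i<p. \<phi> i v x) * (\<Prod>j<q. \<psi> j v x) * exp (s * t)))"

definition system_v :: "complex \<Rightarrow> complex \<Rightarrow> complex \<Rightarrow> complex \<Rightarrow> poly_vx" where
  "system_v lam a b \<mu> =
     const_vx (lam / \<mu>) * (1 - var_x ^ 2) + const_vx a * var_v * var_x + const_vx b * var_v
       + const_vx \<mu> * var_v ^ 2"

definition system_x :: poly_vx where
  "system_x = 1 - var_x ^ 2"

lemma eval_vx_system_v:
  "eval_vx (system_v lam a b \<mu>) v x = lam / \<mu> * (1 - x\<^sup>2) + a * v * x + b * v + \<mu> * v\<^sup>2"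
  by (simp add: eval_vx_def system_v_def const_vx_def var_v_def var_x_def algebra_simps)

lemma eval_vx_system_x: "eval_vx system_x v x = 1 - x\<^sup>2"
  by (simp add: eval_vx_def system_x_def var_x_def)

end

theory Submission
  imports Defs
begin

text \<open>The lines \<open>x - 1 = 0\<close> and \<open>x + 1 = 0\<close> are invariant with cofactors \<open>-(x + 1)\<close> and
  \<open>1 - x\<close>.  With exponents \<open>1/2\<close> and \<open>-1/2\<close> the weighted sum of the cofactors is the
  constant \<open>-1\<close>, which the factor \<open>exp t\<close> compensates.  The branches are controlled locally by the
  principal square root and logarithm: if \<open>r\<close> is a continuous square root of \<open>f\<close> with
  \<open>r\<^sub>0 = r z\<^sub>0 \<noteq> 0\<close>, then near \<open>z\<^sub>0\<close> the quotient \<open>r / r\<^sub>0\<close> stays in the right half-plane.\<close>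

section \<open>Derivatives of square root branches\<close>

text \<open>Among the square roots of a number, \<open>csqrt\<close> is the only one with positive
  real part. Hence \<open>r\<close> agrees near \<open>z\<close> with
  \<open>r z * csqrt (g y / g z)\<close> and inherits its differentiability from
  \<open>csqrt\<close> at 1; mere continuity of the branch suffices.\<close>

lemma has_field_derivative_sqrt_branch:
  fixes r g :: "complex \<Rightarrow> complex"
  assumes cont: "isCont r z" and sq: "\<forall>\<^sub>F y in nhds z. (r y)\<^sup>2 = g y"
    and g: "(g has_field_derivative D) (at z)" and nz: "g z \<noteq> 0"
  shows "(r has_field_derivative D / (2 * r z)) (at z)"
proof -
  have sqz: "(r z)\<^sup>2 = g z"
    using sq by (rule eventually_nhds_x_imp_x)
  then have rz: "r z \<noteq> 0"
    using nz by auto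
  have "((\<lambda>y. Re (r y / r z)) \<longlongrightarrow> Re (r z / r z)) (nhds z)"
    using cont rz by (intro tendsto_intros) (simp add: continuous_at tendsto_at_iff_tendsto_nhds)
  then have "\<forall>\<^sub>F y in nhds z. 0 < Re (r y / r z)"
    by (rule order_tendstoD) (use rz in simp)
  with sq have ev: "\<forall>\<^sub>F y in nhds z. r y = r z * csqrt (g y / g z)"
  proof eventually_elim
    case (elim y)
    then have "csqrt (g y / g z) = r y / r z"
      by (intro csqrt_unique) (auto simp: power_divide sqz)
    then show ?case
      using rz by simp
  qed
  \<comment> \<open>Since \<open>csqrt\<close> has derivative 1/2 at 1, the chain rule gives
    \<open>r z * D / (2 * g z)\<close>, which simplifies because \<open>g z\<close> is the square of
    \<open>r z\<close>.\<close>
  have "((\<lambda>y. r z * csqrt (g y / g z)) has_field_derivative D / (2 * r z)) (at z)"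
    using nz rz
    by (auto intro!: derivative_eq_intros g simp: sqz[symmetric] field_simps power2_eq_square)
  then show ?thesis
    using ev DERIV_cong_ev[OF refl ev refl] by blast
qed

lemma sqrt_branch_isCont:
  assumes "open U" "(v, x) \<in> U" "sqrt_branch U f r"
  shows "isCont (\<lambda>(v, x). r v x) (v, x)"
  using assms by (auto simp: sqrt_branch_def continuous_on_eq_continuous_at)

text \<open>The radicand depends on \<open>x\<close> alone, so along a line in direction
  \<open>v\<close> the branch is a continuous square root of a nonzero constant.\<close>

lemma sqrt_branch_has_field_derivative_v:
  assumes "open U" "(v, x) \<in> U" "sqrt_branch U (\<lambda>v x. g x) r" "g x \<noteq> 0"
  shows "((\<lambda>w. r w x) has_field_derivative 0) (at v)"
proof -
  have "isCont ((\<lambda>(v, x). r v x) \<circ> (\<lambda>w. (w, x))) v"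
    using sqrt_branch_isCont[OF assms(1-3)]
    by (intro continuous_at_compose) (auto intro!: continuous_intros)
  then have c: "isCont (\<lambda>w. r w x) v"
    by (simp add: o_def)
  have "((\<lambda>w. (w, x)) \<longlongrightarrow> (v, x)) (nhds v)"
    by (intro tendsto_intros filterlim_ident)
  then have "\<forall>\<^sub>F w in nhds v. (w, x) \<in> U"
    using assms(1,2) by (rule topological_tendstoD)
  then have ev: "\<forall>\<^sub>F w in nhds v. (r w x)\<^sup>2 = g x"
    by eventually_elim (use assms(3) in \<open>auto simp: sqrt_branch_def\<close>)
  show ?thesis
    using has_field_derivative_sqrt_branch[OF c ev DERIV_const assms(4)] by simp
qed

lemma sqrt_branch_has_field_derivative_x:
  assumes "open U" "(v, x) \<in> U" "sqrt_branch U (\<lambda>v x. g x) r" "g x \<noteq> 0"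
    and "(g has_field_derivative D) (at x)"
  shows "((\<lambda>y. r v y) has_field_derivative D / (2 * r v x)) (at x)"
proof -
  have "isCont ((\<lambda>(v, x). r v x) \<circ> (\<lambda>y. (v, y))) x"
    using sqrt_branch_isCont[OF assms(1-3)]
    by (intro continuous_at_compose) (auto intro!: continuous_intros)
  then have c: "isCont (\<lambda>y. r v y) x"
    by (simp add: o_def)
  have "((\<lambda>y. (v, y)) \<longlongrightarrow> (v, x)) (nhds x)"
    by (intro tendsto_intros filterlim_ident)
  then have "\<forall>\<^sub>F y in nhds x. (v, y) \<in> U"
    using assms(1,2) by (rule topological_tendstoD)
  then have ev: "\<forall>\<^sub>F y in nhds x. (r v y)\<^sup>2 = g y"
    by eventually_elim (use assms(3) in \<open>auto simp: sqrt_branch_def\<close>)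
  show ?thesis
    using has_field_derivative_sqrt_branch[OF c ev assms(5,4)] .
qed

section \<open>Local logarithms and existence of branches\<close>

lemma sqrt_branch_local_log:
  assumes "open U" "z \<in> U" "sqrt_branch U f r" "\<forall>(v, x)\<in>U. f v x \<noteq> 0"
  obtains V l where "open V" "z \<in> V" "V \<subseteq> U" "continuous_on V (\<lambda>(v, x). l v x)"
    "\<And>v x. (v, x) \<in> V \<Longrightarrow> exp (l v x) = r v x"
proof -
  define R where "R = (\<lambda>(v, x). r v x)"
  have cont: "continuous_on U R" and sq: "\<And>v x. (v, x) \<in> U \<Longrightarrow> (r v x)\<^sup>2 = f v x"
    using assms(3) by (auto simp: sqrt_branch_def R_def)
  have Rz: "R z \<noteq> 0"
    using sq assms(2,4) by (cases z) (fastforce simp: R_def)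
  define V where "V = {w \<in> U. 0 < Re (R w / R z)}"
  \<comment> \<open>Dividing by \<open>R z\<close> moves the values on \<open>V\<close> into the
    right half-plane, away from the cut of \<open>Ln\<close>; adding \<open>Ln (R z)\<close>
    restores the factor.\<close>
  define l where "l = (\<lambda>v x. Ln (R z) + Ln (r v x / R z))"
  show thesis
  proof
    have "open (U \<inter> (\<lambda>w. Re (R w / R z)) -` {0<..})"
      using Rz assms(1) by (intro continuous_open_preimage continuous_intros cont) auto
    then show "open V"
      by (simp add: V_def Int_def)
    show "z \<in> V" "V \<subseteq> U"
      using Rz assms(2) by (auto simp: V_def)
    have "continuous_on V (\<lambda>w. Ln (R z) + Ln (R w / R z))"
      using Rz
      by (intro continuous_intros continuous_on_subset[OF cont])
         (auto simp: V_def complex_nonpos_Reals_iff)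
    then show "continuous_on V (\<lambda>(v, x). l v x)"
      by (simp add: l_def R_def case_prod_unfold)
    fix v x assume vx: "(v, x) \<in> V"
    then have "r v x / R z \<noteq> 0"
      by (auto simp: V_def R_def)
    then show "exp (l v x) = r v x"
      using Rz by (simp add: l_def exp_add)
  qed
qed

text \<open>The logarithm is taken of the root \<open>r\<close>, not of \<open>f\<close>, and then
  doubled. Halving it again returns \<open>r\<close> itself, so no sign ambiguity arises.\<close>

lemma sqrt_branch_imp_power_branch:
  assumes "open U" "sqrt_branch U f r" "\<forall>(v, x)\<in>U. f v x \<noteq> 0"
  shows "power_branch U f (1/2) r" "power_branch U f (-1/2) (\<lambda>v x. inverse (r v x))"
proof -
  have sq: "\<And>v x. (v, x) \<in> U \<Longrightarrow> (r v x)\<^sup>2 = f v x"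
    using assms(2) by (auto simp: sqrt_branch_def)
  have "\<exists>V l. open V \<and> z \<in> V \<and> V \<subseteq> U \<and> continuous_on V (\<lambda>(v, x). l v x) \<and>
      (\<forall>(v, x)\<in>V. exp (l v x) = f v x \<and> r v x = exp (1/2 * l v x) \<and>
         inverse (r v x) = exp (-1/2 * l v x))" if z: "z \<in> U" for z
  proof -
    obtain V l where V: "open V" "z \<in> V" "V \<subseteq> U" "continuous_on V (\<lambda>(v, x). l v x)"
      and l: "\<And>v x. (v, x) \<in> V \<Longrightarrow> exp (l v x) = r v x"
      using sqrt_branch_local_log[OF assms(1) z assms(2,3)] by blast
    have "continuous_on V (\<lambda>w. 2 * (case w of (v, x) \<Rightarrow> l v x))"
      by (intro continuous_intros V)
    then have "continuous_on V (\<lambda>(v, x). 2 * l v x)"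
      by (simp add: case_prod_unfold)
    moreover have "exp (2 * l v x) = f v x \<and> r v x = exp (1/2 * (2 * l v x)) \<and>
        inverse (r v x) = exp (-1/2 * (2 * l v x))" if "(v, x) \<in> V" for v x
      using l[OF that] sq[of v x] that V(3) by (auto simp: exp_double exp_minus)
    ultimately show ?thesis
      using V(1-3) by (intro exI[of _ V] exI[of _ "\<lambda>v x. 2 * l v x"]) auto
  qed
  then show "power_branch U f (1/2) r" "power_branch U f (-1/2) (\<lambda>v x. inverse (r v x))"
    unfolding power_branch_def by (fast+)
qed

text \<open>On a disc about \<open>x\<^sub>0\<close> that omits \<open>a\<close>, the ratio
  \<open>(x - a) / (x\<^sub>0 - a)\<close> has distance less than 1 from 1. It therefore avoids the
  cut of \<open>csqrt\<close>, and multiplying by one root of \<open>x\<^sub>0 - a\<close> gives a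
  branch.\<close>

lemma sqrt_branch_exists:
  fixes a x\<^sub>0 :: complex
  assumes "\<forall>(v, x)\<in>U. dist x\<^sub>0 x < dist x\<^sub>0 a"
  shows "\<exists>r. sqrt_branch U (\<lambda>v x. x - a) r"
proof
  have ne: "x\<^sub>0 - a \<noteq> 0" if "(v, x) \<in> U" for v x
    using assms that by fastforce
  have pos: "0 < Re ((x - a) / (x\<^sub>0 - a))" if vx: "(v, x) \<in> U" for v x
  proof -
    have "(x - a) / (x\<^sub>0 - a) = 1 - (x\<^sub>0 - x) / (x\<^sub>0 - a)"
      using ne[OF vx] by (simp add: field_simps)
    moreover have "norm ((x\<^sub>0 - x) / (x\<^sub>0 - a)) < 1"
      using assms vx ne[OF vx] by (auto simp: norm_divide dist_norm)
    ultimately show ?thesis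
      using complex_Re_le_cmod[of "(x\<^sub>0 - x) / (x\<^sub>0 - a)"] by simp
  qed
  have "(x - a) / (x\<^sub>0 - a) \<notin> \<real>\<^sub>\<le>\<^sub>0" if "(v, x) \<in> U" for v x
    using pos[OF that] by (auto simp: complex_nonpos_Reals_iff)
  moreover have "continuous_on U (\<lambda>w. (snd w - a) / (x\<^sub>0 - a))"
    using ne by (intro continuous_intros) auto
  ultimately have "continuous_on U (\<lambda>w. csqrt (x\<^sub>0 - a) * csqrt ((snd w - a) / (x\<^sub>0 - a)))"
    by (intro continuous_on_mult_left continuous_on_compose2[OF continuous_on_csqrt]) auto
  then show "sqrt_branch U (\<lambda>v x. x - a) (\<lambda>v x. csqrt (x\<^sub>0 - a) * csqrt ((x - a) / (x\<^sub>0 - a)))"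
    using ne by (auto simp: sqrt_branch_def case_prod_unfold power_mult_distrib)
qed

section \<open>Invariant lines and constancy along solutions\<close>

lemma eval_vx_const_x: "eval_vx [:p:] v x = poly p x"
  by (simp add: eval_vx_def)

text \<open>The polynomial is constant in \<open>v\<close>, so the term with \<open>P\<close>
  vanishes, and \<open>c\<^sup>2 = 1\<close> factors \<open>1 - x\<^sup>2\<close> as
  \<open>(- c - x) * (x - c)\<close>.\<close>

lemma invariant_algebraic_curve_line:
  fixes c :: complex
  assumes "c\<^sup>2 = 1"
  shows "invariant_algebraic_curve P system_x [:[:- c, 1:]:]"
proof -
  have "irreducible [:[:- c, 1:]:]"
    by (simp add: irreducible_const_poly_iff irreducible_linear_field_poly)
  moreover have "vfield_poly P system_x [:[:- c, 1:]:] = [:[:- c, -1:]:] * [:[:- c, 1:]:]"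
    using assms
    by (simp add: vfield_poly_def system_x_def var_x_def map_poly_pCons pderiv_pCons
        power2_eq_square one_pCons)
  ultimately show ?thesis
    unfolding invariant_algebraic_curve_def by blast
qed

lemma is_invariant_sqrt_quotient:
  assumes U: "open U" "U \<noteq> {}" and off: "\<forall>(v, x)\<in>U. x \<noteq> 1 \<and> x \<noteq> -1"
    and r1: "sqrt_branch U (\<lambda>v x. x - 1) r\<^sub>1" and r2: "sqrt_branch U (\<lambda>v x. x + 1) r\<^sub>2"
  shows "is_invariant P system_x U (\<lambda>v x t. r\<^sub>1 v x / r\<^sub>2 v x * exp t)"
  unfolding is_invariant_def
proof (intro conjI)
  have sq: "(r\<^sub>1 v x)\<^sup>2 = x - 1" "(r\<^sub>2 v x)\<^sup>2 = x + 1" if "(v, x) \<in> U" for v x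
    using r1 r2 that by (auto simp: sqrt_branch_def)
  have x: "x - 1 \<noteq> 0" "x + 1 \<noteq> 0" if "(v, x) \<in> U" for v x
    using off that by (auto simp: add_eq_0_iff2)
  have nz: "r\<^sub>1 v x \<noteq> 0" "r\<^sub>2 v x \<noteq> 0" if "(v, x) \<in> U" for v x
    using sq[OF that] x[OF that] by auto
  show "\<not> (\<exists>c. \<forall>(v, x)\<in>U. \<forall>t. r\<^sub>1 v x / r\<^sub>2 v x * exp t = c)"
  proof
    assume "\<exists>c. \<forall>(v, x)\<in>U. \<forall>t. r\<^sub>1 v x / r\<^sub>2 v x * exp t = c"
    then obtain c where c: "\<And>v x t. (v, x) \<in> U \<Longrightarrow> r\<^sub>1 v x / r\<^sub>2 v x * exp t = c"
      by blast
    obtain v x where vx: "(v, x) \<in> U"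
      using U(2) by auto
    \<comment> \<open>Non-constancy is tested at times 0 and 1 over a single point. The complex
      exponential is periodic, so time 1 is written as a real number to reduce to injectivity of the
      real exponential.\<close>
    have "exp (complex_of_real 1) = exp 0"
      using c[OF vx, of 0] c[OF vx, of "complex_of_real 1"] nz[OF vx] by auto
    then show False
      unfolding exp_of_real by (metis exp_eq_one_iff exp_zero of_real_eq_1_iff zero_neq_one)
  qed
  show "\<forall>(v, x)\<in>U. \<forall>t.
      (\<lambda>w. r\<^sub>1 w x / r\<^sub>2 w x * exp t) field_differentiable at v \<and>
      (\<lambda>y. r\<^sub>1 v y / r\<^sub>2 v y * exp t) field_differentiable at x \<and>
      (\<lambda>u. r\<^sub>1 v x / r\<^sub>2 v x * exp u) field_differentiable at t \<and>
      deriv (\<lambda>u. r\<^sub>1 v x / r\<^sub>2 v x * exp u) t +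
        vfield_fun P system_x (\<lambda>w y. r\<^sub>1 w y / r\<^sub>2 w y * exp t) v x = 0"
  proof (clarify, intro conjI)
    fix v x t assume vx: "(v, x) \<in> U"
    note nz' = nz[OF vx] and sq' = sq[OF vx] and x' = x[OF vx]
    note dv = sqrt_branch_has_field_derivative_v[OF U(1) vx r1 x'(1)]
      sqrt_branch_has_field_derivative_v[OF U(1) vx r2 x'(2)]
    have "((\<lambda>x. x - 1 :: complex) has_field_derivative 1) (at x)"
      "((\<lambda>x. x + 1 :: complex) has_field_derivative 1) (at x)"
      by (auto intro!: derivative_eq_intros)
    note dx = sqrt_branch_has_field_derivative_x[OF U(1) vx r1 x'(1) this(1)]
      sqrt_branch_has_field_derivative_x[OF U(1) vx r2 x'(2) this(2)]
    have Dv: "((\<lambda>w. r\<^sub>1 w x / r\<^sub>2 w x * exp t) has_field_derivative 0) (at v)"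
      using nz' by (auto intro!: derivative_eq_intros dv)
    have Dt: "((\<lambda>u. r\<^sub>1 v x / r\<^sub>2 v x * exp u) has_field_derivative r\<^sub>1 v x / r\<^sub>2 v x * exp t) (at t)"
      using nz' by (auto intro!: derivative_eq_intros)
    \<comment> \<open>The numerator of the quotient rule reduces to the difference of the squares,
      \<open>(x + 1) - (x - 1) = 2\<close>, which cancels the 2 from the root derivatives.\<close>
    have "((r\<^sub>2 v x)\<^sup>2 - (r\<^sub>1 v x)\<^sup>2) / (2 * r\<^sub>1 v x * r\<^sub>2 v x ^ 3) = 1 / (r\<^sub>1 v x * r\<^sub>2 v x ^ 3)"
      using nz' by (simp add: sq' divide_simps)
    then have "(1 / (2 * r\<^sub>1 v x) * r\<^sub>2 v x - r\<^sub>1 v x * (1 / (2 * r\<^sub>2 v x))) / (r\<^sub>2 v x * r\<^sub>2 v x)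
        = 1 / (r\<^sub>1 v x * r\<^sub>2 v x ^ 3)"
      using nz' by (simp add: field_simps power2_eq_square power3_eq_cube)
    then have Dx: "((\<lambda>y. r\<^sub>1 v y / r\<^sub>2 v y * exp t) has_field_derivative
        exp t / (r\<^sub>1 v x * r\<^sub>2 v x ^ 3)) (at x)"
      using DERIV_cmult_right[OF DERIV_divide[OF dx nz'(2)], of "exp t"] by simp
    show "(\<lambda>w. r\<^sub>1 w x / r\<^sub>2 w x * exp t) field_differentiable at v"
      "(\<lambda>y. r\<^sub>1 v y / r\<^sub>2 v y * exp t) field_differentiable at x"
      "(\<lambda>u. r\<^sub>1 v x / r\<^sub>2 v x * exp u) field_differentiable at t"
      using Dv Dx Dt unfolding field_differentiable_def by blast+
    \<comment> \<open>In this form the product with the \<open>x\<close>-derivative is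
      \<open>- r\<^sub>1 v x / r\<^sub>2 v x * exp t\<close>, the negative of the time
      derivative.\<close>
    have "eval_vx system_x v x = - ((r\<^sub>1 v x)\<^sup>2 * (r\<^sub>2 v x)\<^sup>2)"
      unfolding eval_vx_system_x sq' by (simp add: algebra_simps power2_eq_square)
    then show "deriv (\<lambda>u. r\<^sub>1 v x / r\<^sub>2 v x * exp u) t +
        vfield_fun P system_x (\<lambda>w y. r\<^sub>1 w y / r\<^sub>2 w y * exp t) v x = 0"
      unfolding vfield_fun_def DERIV_imp_deriv[OF Dv] DERIV_imp_deriv[OF Dx] DERIV_imp_deriv[OF Dt]
      using nz' by (simp add: field_simps power2_eq_square power3_eq_cube)
  qed
qed

section \<open>Assembling the Darboux invariant\<close>

lemma darboux_invariantI_curves: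
  fixes p :: nat
  assumes "is_invariant P Q U I"
    and "\<And>i. i < p \<Longrightarrow>
      invariant_algebraic_curve P Q (f i) \<and> power_branch U (eval_vx (f i)) (c i) (\<phi> i)"
    and "k < p" "c k \<noteq> 0" "s \<noteq> 0"
    and "\<And>v x t. (v, x) \<in> U \<Longrightarrow> I v x t = (\<Prod>i<p. \<phi> i v x) * exp (s * t)"
  shows "darboux_invariant P Q U I"
  unfolding darboux_invariant_def
proof (intro conjI)
  have nz: "(\<exists>i<p. c i \<noteq> 0) \<or> (\<exists>j<0. c j \<noteq> 0)"
    using assms(3,4) by blast
  have prod: "\<forall>(v, x)\<in>U. \<forall>t. I v x t =
      (\<Prod>i<p. \<phi> i v x) * (\<Prod>j<0::nat. \<phi> j v x) * exp (s * t)"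
    using assms(6) by auto
  show "\<exists>(p::nat) (q::nat) f c \<phi> g h d \<psi> s.
      (\<forall>i<p. invariant_algebraic_curve P Q (f i) \<and> power_branch U (eval_vx (f i)) (c i) (\<phi> i)) \<and>
      (\<forall>j<q. exponential_factor P Q (g j) (h j) \<and> (\<forall>(v, x)\<in>U. eval_vx (h j) v x \<noteq> 0) \<and>
         power_branch U (exp_quotient (g j) (h j)) (d j) (\<psi> j)) \<and>
      ((\<exists>i<p. c i \<noteq> 0) \<or> (\<exists>j<q. d j \<noteq> 0)) \<and> s \<noteq> 0 \<and>
      (\<forall>(v, x)\<in>U. \<forall>t. I v x t = (\<Prod>i<p. \<phi> i v x) * (\<Prod>j<q. \<psi> j v x) * exp (s * t))"
    \<comment> \<open>With \<open>q = 0\<close> the conditions on exponential factors are vacuous;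
      \<open>f\<close>, \<open>f\<close>, \<open>c\<close>, \<open>\<phi>\<close> merely fill the
      places of \<open>g\<close>, \<open>h\<close>, \<open>d\<close>, \<open>\<psi>\<close>.\<close>
    by (rule exI[of _ p], rule exI[of _ "0::nat"], rule exI[of _ f], rule exI[of _ c],
        rule exI[of _ \<phi>], rule exI[of _ f], rule exI[of _ f], rule exI[of _ c],
        rule exI[of _ \<phi>], rule exI[of _ s])
       (use assms(2,5) nz prod in blast)
qed (fact assms(1))

lemma darboux_invariant_sqrt_quotient:
  assumes U: "open U" "U \<noteq> {}" and off: "\<forall>(v, x)\<in>U. x \<noteq> 1 \<and> x \<noteq> -1"
    and r1: "sqrt_branch U (\<lambda>v x. x - 1) r\<^sub>1" and r2: "sqrt_branch U (\<lambda>v x. x + 1) r\<^sub>2"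
  shows "darboux_invariant P system_x U (\<lambda>v x t. r\<^sub>1 v x / r\<^sub>2 v x * exp t)"
proof -
  \<comment> \<open>The double negation keeps the second line in the shape of
    \<open>invariant_algebraic_curve_line\<close> with \<open>c = -1\<close>.\<close>
  define f :: "nat \<Rightarrow> poly_vx" where "f i = (if i = 0 then [:[:- 1, 1:]:] else [:[:- (- 1), 1:]:])" for i
  define c :: "nat \<Rightarrow> complex" where "c i = (if i = 0 then 1/2 else -1/2)" for i
  define \<phi> where "\<phi> i = (if i = 0 then r\<^sub>1 else (\<lambda>v x. inverse (r\<^sub>2 v x)))" for i :: nat
  have e: "eval_vx (f 0) = (\<lambda>v x. x - 1)" "eval_vx (f (Suc 0)) = (\<lambda>v x. x + 1)"
    by (auto simp: f_def eval_vx_const_x fun_eq_iff)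
  have x: "\<forall>(v, x)\<in>U. x - 1 \<noteq> 0" "\<forall>(v, x)\<in>U. x + 1 \<noteq> 0"
    using off by (auto simp: add_eq_0_iff2)
  have curves: "invariant_algebraic_curve P system_x (f i) \<and> power_branch U (eval_vx (f i)) (c i) (\<phi> i)"
    if "i < 2" for i
  proof -
    consider "i = 0" | "i = Suc 0"
      using less_2_cases[OF \<open>i < 2\<close>] by auto
    then show ?thesis
    proof cases
      case 1
      then show ?thesis
        using invariant_algebraic_curve_line[of 1 P] sqrt_branch_imp_power_branch(1)[OF U(1) r1 x(1)]
        unfolding 1 e by (simp add: f_def c_def \<phi>_def)
    next
      case 2
      then show ?thesis
        using invariant_algebraic_curve_line[of "-1" P] sqrt_branch_imp_power_branch(2)[OF U(1) r2 x(2)]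
        unfolding 2 e by (simp add: f_def c_def \<phi>_def)
    qed
  qed
  show ?thesis
  proof (rule darboux_invariantI_curves)
    show "is_invariant P system_x U (\<lambda>v x t. r\<^sub>1 v x / r\<^sub>2 v x * exp t)"
      by (rule is_invariant_sqrt_quotient[OF assms])
    show "invariant_algebraic_curve P system_x (f i) \<and>
        power_branch U (eval_vx (f i)) (c i) (\<phi> i)" if "i < 2" for i
      using that by (rule curves)
    show "0 < (2 :: nat)" "c 0 \<noteq> 0" "(1 :: complex) \<noteq> 0"
      by (simp_all add: c_def)
    show "r\<^sub>1 v x / r\<^sub>2 v x * exp t = (\<Prod>i<2. \<phi> i v x) * exp (1 * t)" for v x t
      by (simp add: \<phi>_def numeral_2_eq_2 divide_inverse)
  qed
qed

text \<open>The first conjunct keeps the second from being vacuous: branches exist around every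
  point off the two lines. The second then covers every choice of branches on a connected
  domain.\<close>

theorem proposition2p4:
  fixes lam a b \<mu> :: complex
  assumes "\<mu> \<noteq> 0"
  shows
    "(\<forall>v\<^sub>0 x\<^sub>0. x\<^sub>0 \<noteq> 1 \<and> x\<^sub>0 \<noteq> -1 \<longrightarrow>
        (\<exists>U r\<^sub>1 r\<^sub>2. open U \<and> connected U \<and> (v\<^sub>0, x\<^sub>0) \<in> U \<and> (\<forall>(v, x)\<in>U. x \<noteq> 1 \<and> x \<noteq> -1) \<and>
           sqrt_branch U (\<lambda>v x. x - 1) r\<^sub>1 \<and> sqrt_branch U (\<lambda>v x. x + 1) r\<^sub>2)) \<and>
     (\<forall>U r\<^sub>1 r\<^sub>2. open U \<and> connected U \<and> U \<noteq> {} \<and> (\<forall>(v, x)\<in>U. x \<noteq> 1 \<and> x \<noteq> -1) \<and>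
        sqrt_branch U (\<lambda>v x. x - 1) r\<^sub>1 \<and> sqrt_branch U (\<lambda>v x. x + 1) r\<^sub>2 \<longrightarrow>
        darboux_invariant (system_v lam a b \<mu>) system_x U
          (\<lambda>v x t. r\<^sub>1 v x / r\<^sub>2 v x * exp t))"
proof (intro conjI allI impI)
  fix v\<^sub>0 x\<^sub>0 :: complex assume x0: "x\<^sub>0 \<noteq> 1 \<and> x\<^sub>0 \<noteq> -1"
  \<comment> \<open>The radius is the distance from \<open>x\<^sub>0\<close> to the nearer of 1 and
    -1, so one disc carries both square roots.\<close>
  define U :: "(complex \<times> complex) set"
    where "U = UNIV \<times> ball x\<^sub>0 (min (dist x\<^sub>0 1) (dist x\<^sub>0 (-1)))"
  obtain r\<^sub>1 where "sqrt_branch U (\<lambda>v x. x - 1) r\<^sub>1"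
    using sqrt_branch_exists[of U x\<^sub>0 1] by (auto simp: U_def)
  moreover obtain r\<^sub>2 where "sqrt_branch U (\<lambda>v x. x - (-1)) r\<^sub>2"
    using sqrt_branch_exists[of U x\<^sub>0 "-1"] by (auto simp: U_def)
  moreover have "open U" "connected U"
    by (auto simp: U_def intro!: open_Times connected_Times)
  moreover have "(v\<^sub>0, x\<^sub>0) \<in> U" "\<forall>(v, x)\<in>U. x \<noteq> 1 \<and> x \<noteq> -1"
    using x0 by (auto simp: U_def)
  ultimately show "\<exists>U r\<^sub>1 r\<^sub>2. open U \<and> connected U \<and> (v\<^sub>0, x\<^sub>0) \<in> U \<and>
      (\<forall>(v, x)\<in>U. x \<noteq> 1 \<and> x \<noteq> -1) \<and>
      sqrt_branch U (\<lambda>v x. x - 1) r\<^sub>1 \<and> sqrt_branch U (\<lambda>v x. x + 1) r\<^sub>2"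
    by (intro exI[of _ U] exI[of _ r\<^sub>1] exI[of _ r\<^sub>2]) simp
qed (blast intro: darboux_invariant_sqrt_quotient)

end
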